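(* Let $\{\sigma_i\}_{i\in I}$ be a family of contiguous patterns. In (i), for each $i\in I$ let $k_i$ be an integer greater than all letters of $\sigma_i$; in (ii), assume that all letters of every $\sigma_i$ are greater than $1$. Let $n\ge 1$ and $\pi\in\mathcal{S}_n$. Write $\pi=\pi_{\ell}\,n\,\pi_r$, where $\pi_\ell$ and $\pi_r$ are the parts of $\pi$ to the left and to the right of the letter $n$, and $\pi=\widehat{\pi}_{\ell}\,1\,\widehat{\pi}_r$, where $\widehat{\pi}_\ell$ and $\widehat{\pi}_r$ are the parts of $\pi$ to the left and to the right of the letter $1$. Then: (i) $\pi$ avoids all the patterns $k_i$-$\sigma_i$-$k_i$ ($i\in I$) if and only if $\pi_\ell$ avoids all the patterns $k_i$-$\sigma_i$ ($i\in I$) and $\pi_r$ avoids all the patterns $\sigma_i$-$k_i$ ($i\in I$). (ii) $\pi$ avoids all the patterns $1$-$\sigma_i$-$1$ ($i\in I$) if and only if $\widehat{\pi}_\ell$ avoids all the patterns $1$-$\sigma_i$ ($i\in I$) and $\widehat{\pi}_r$ avoids all the patterns $\sigma_i$-$1$ ($i\in I$).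
   Context: $\mathcal{S}_n$ is the set of permutations of $[n]=\{1,\dots,n\}$, written as words. A (partially ordered generalized) pattern is a nonempty word $p_1p_2\dots p_m$ of positive integers (repetitions allowed) with a dash written between some of the consecutive letters; it is contiguous if it has no dashes. An occurrence of it in a word $w=a_1\dots a_N$ of distinct integers (in particular in a permutation or a factor of a permutation) is a subsequence $a_{j_1}a_{j_2}\dots a_{j_m}$, $j_1<\dots<j_m$, such that (a) $p_s>p_t$ implies $a_{j_s}>a_{j_t}$ for all $s,t$ (no condition when $p_s=p_t$), and (b) $j_{s+1}=j_s+1$ whenever $p_s$ and $p_{s+1}$ are not separated by a dash. $w$ avoids the pattern if it has no occurrence of it. The notation $k$-$\sigma$-$k$ means the letter $k$, a dash, $\sigma$, a dash, and again the letter $k$; similarly for $k$-$\sigma$ and $\sigma$-$k$. *)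

theory Defs
  imports "HOL-Combinatorics.Multiset_Permutations"
begin

text \<open>
  A pattern is given by the list of its maximal dash-free blocks: \<open>1-23-1\<close> is
  \<open>[[1], [2, 3], [1]]\<close>. Joining two patterns by a dash is therefore list append.
\<close>

type_synonym pattern = "nat list list"

definition is_pattern :: "pattern \<Rightarrow> bool" where
  "is_pattern P \<longleftrightarrow> P \<noteq> [] \<and> (\<forall>b\<in>set P. b \<noteq> []) \<and> (\<forall>x\<in>set (concat P). 0 < x)"

definition contiguous_pattern :: "pattern \<Rightarrow> bool" where
  "contiguous_pattern P \<longleftrightarrow> is_pattern P \<and> length P = 1"

text \<open>
  Positions are counted from \<open>0\<close>; \<open>dash_after P s\<close> says that the letters \<open>concat P ! s\<close> and
  \<open>concat P ! Suc s\<close> are separated by a dash, i.e. that a proper prefix of blocks ends at \<open>s\<close>.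
\<close>

definition dash_after :: "pattern \<Rightarrow> nat \<Rightarrow> bool" where
  "dash_after P s \<longleftrightarrow> (\<exists>r. 0 < r \<and> r < length P \<and> length (concat (take r P)) = Suc s)"

text \<open>
  \<open>j\<close> maps the positions of the pattern to positions of the word \<open>w\<close> (only its values below the
  number of letters matter). The notion is intended for words \<open>w\<close> with distinct letters.
\<close>

definition is_occurrence :: "pattern \<Rightarrow> 'a::linorder list \<Rightarrow> (nat \<Rightarrow> nat) \<Rightarrow> bool" where
  "is_occurrence P w j \<longleftrightarrow>
     (let p = concat P; m = length p in
        strict_mono_on {..<m} j \<and>
        (\<forall>s<m. j s < length w) \<and>
        (\<forall>s<m. \<forall>t<m. p ! s > p ! t \<longrightarrow> w ! j s > w ! j t) \<and>
        (\<forall>s. Suc s < m \<and> \<not> dash_after P s \<longrightarrow> j (Suc s) = j s + 1))"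

definition avoids :: "'a::linorder list \<Rightarrow> pattern \<Rightarrow> bool" where
  "avoids w P \<longleftrightarrow> \<not> (\<exists>j. is_occurrence P w j)"

end

theory Submission
  imports Defs
begin

text \<open>
  In an occurrence of \<open>k\<close>-\<open>\<sigma>\<close>-\<open>k\<close> the factor playing the role of \<open>\<sigma>\<close> is smaller than some other
  letter, so it misses the maximal letter and lies entirely on one side of it; the letter for \<open>k\<close> on
  the far side may then be dropped. Conversely, the maximal letter can always serve as the missing
  \<open>k\<close>. For \<open>1\<close>-\<open>\<sigma>\<close>-\<open>1\<close> the order is reversed, so both cases are treated at once for a letter \<open>x\<close>
  that is an extremum with respect to \<open>\<sigma>\<close>.
\<close>

definition factor_occ :: "nat list \<Rightarrow> 'a::linorder list \<Rightarrow> nat \<Rightarrow> bool" where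
  "factor_occ q w b \<longleftrightarrow> b + length q \<le> length w \<and>
     (\<forall>s<length q. \<forall>t<length q. q ! s > q ! t \<longrightarrow> w ! (b + s) > w ! (b + t))"

text \<open>The outer letter \<open>x\<close> of the pattern is represented by a value
  \<open>v\<close>, not by a position, so passing from the word to one side of the extremum changes
  only \<open>b\<close>.\<close>

definition letter_compat :: "nat \<Rightarrow> nat list \<Rightarrow> 'a::linorder \<Rightarrow> 'a list \<Rightarrow> nat \<Rightarrow> bool" where
  "letter_compat x q v w b \<longleftrightarrow>
     (\<forall>s<length q. (q ! s < x \<longrightarrow> w ! (b + s) < v) \<and> (x < q ! s \<longrightarrow> v < w ! (b + s)))"

lemma consecutive_nat_fun:
  fixes f :: "nat \<Rightarrow> nat"
  assumes "\<And>s. Suc s < m \<Longrightarrow> f (Suc s) = f s + 1" and "s < m"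
  shows "f s = f 0 + s"
  using assms(2) by (induction s) (auto simp: assms(1))

lemma dash_after_left:
  "dash_after [[x], q] s \<longleftrightarrow> s = 0"
proof -
  have "dash_after [[x], q] s \<longleftrightarrow> (\<exists>r\<in>{1}. length (concat (take r [[x], q])) = Suc s)"
    unfolding dash_after_def
    by (intro iffI; force simp: less_Suc_eq numeral_2_eq_2)
  then show ?thesis by auto
qed

lemma dash_after_right:
  "dash_after [q, [x]] s \<longleftrightarrow> length q = Suc s"
proof -
  have "dash_after [q, [x]] s \<longleftrightarrow> (\<exists>r\<in>{1}. length (concat (take r [q, [x]])) = Suc s)"
    unfolding dash_after_def
    by (intro iffI; force simp: less_Suc_eq numeral_2_eq_2)
  then show ?thesis by auto
qed

text \<open>The proper nonempty block prefixes are those with \<open>r = 1\<close> and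
  \<open>r = 2\<close>. They have 1 and \<open>1 + length q\<close> letters, so they end at
  positions 0 and \<open>length q\<close>.\<close>

lemma dash_after_both:
  "dash_after [[x], q, [x]] s \<longleftrightarrow> s = 0 \<or> length q = s"
proof -
  have "dash_after [[x], q, [x]] s \<longleftrightarrow> (\<exists>r\<in>{1,2}. length (concat (take r [[x], q, [x]])) = Suc s)"
    unfolding dash_after_def
    by (intro iffI; force simp: less_Suc_eq numeral_2_eq_2)
  then show ?thesis by (auto simp: numeral_2_eq_2)
qed

text \<open>The block \<open>q\<close> has no dash, so its image is an interval of positions fixed
  by its start \<open>b\<close>. An embedding thus reduces to two numbers, \<open>b\<close> and the
  position \<open>a\<close> of the letter playing \<open>x\<close>.\<close>

lemma avoids_left_iff:
  assumes "q \<noteq> []"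
  shows "avoids w [[x], q] \<longleftrightarrow>
    \<not> (\<exists>a b. a < b \<and> factor_occ q w b \<and> letter_compat x q (w ! a) w b)"
proof -
  let ?m = "length q"
  have m: "0 < ?m" using assms by simp
  have "(\<exists>j. is_occurrence [[x], q] w j) \<longleftrightarrow>
    (\<exists>a b. a < b \<and> factor_occ q w b \<and> letter_compat x q (w ! a) w b)" (is "?L \<longleftrightarrow> ?R")
  proof
    assume ?L
    then obtain j where j: "is_occurrence [[x], q] w j" by blast
    define b where "b = j (Suc 0)"
    have shift: "j (Suc s) = b + s" if "s < ?m" for s
      using consecutive_nat_fun[of ?m "\<lambda>s. j (Suc s)" s] j that
      by (auto simp: b_def is_occurrence_def Let_def dash_after_left)
    have "j 0 < b"
      using j m unfolding b_def by (auto simp: is_occurrence_def Let_def strict_mono_on_def)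
    \<comment> \<open>The last letter of the block lies inside \<open>w\<close>; as \<open>q\<close>
      is nonempty, this is the length bound in \<open>factor_occ\<close>.\<close>
    moreover have "b + (?m - 1) < length w"
      using j m shift[of "?m - 1"] by (auto simp: is_occurrence_def Let_def)
    ultimately show ?R using j m
      by (intro exI[of _ "j 0"] exI[of _ b])
         (auto simp: is_occurrence_def Let_def factor_occ_def letter_compat_def All_less_Suc2 shift)
  next
    assume ?R
    then obtain a b where "a < b" "factor_occ q w b" "letter_compat x q (w ! a) w b" by blast
    then have "is_occurrence [[x], q] w (case_nat a (\<lambda>s. b + s))"
      unfolding is_occurrence_def Let_def strict_mono_on_def
      by (auto simp: factor_occ_def letter_compat_def All_less_Suc2 dash_after_left
               split: nat.split)
    then show ?L by blast
  qed
  then show ?thesis by (simp add: avoids_def)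
qed

text \<open>As for a leading letter, but now \<open>x\<close> comes last: its position
  \<open>c\<close> needs a bound of its own, since \<open>factor_occ\<close> bounds only the factor
  before it.\<close>

lemma avoids_right_iff:
  assumes "q \<noteq> []"
  shows "avoids w [q, [x]] \<longleftrightarrow>
    \<not> (\<exists>b c. b + length q \<le> c \<and> c < length w \<and> factor_occ q w b \<and> letter_compat x q (w ! c) w b)"
proof -
  let ?m = "length q"
  have m: "0 < ?m" using assms by simp
  have "(\<exists>j. is_occurrence [q, [x]] w j) \<longleftrightarrow>
    (\<exists>b c. b + ?m \<le> c \<and> c < length w \<and> factor_occ q w b \<and> letter_compat x q (w ! c) w b)"
    (is "?L \<longleftrightarrow> ?R")
  proof
    assume ?L
    then obtain j where j: "is_occurrence [q, [x]] w j" by blast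
    define b where "b = j 0"
    have shift: "j s = b + s" if "s < ?m" for s
      using consecutive_nat_fun[of ?m j s] j that
      by (auto simp: b_def is_occurrence_def Let_def dash_after_right)
    have "j (?m - 1) < j ?m"
      using j m by (auto simp: is_occurrence_def Let_def strict_mono_on_def)
    then have "b + ?m \<le> j ?m" using m shift[of "?m - 1"] by auto
    moreover have "j ?m < length w" using j by (auto simp: is_occurrence_def Let_def)
    ultimately show ?R using j
      by (intro exI[of _ b] exI[of _ "j ?m"])
         (auto simp: is_occurrence_def Let_def factor_occ_def letter_compat_def All_less_Suc
           nth_append shift)
  next
    assume ?R
    then obtain b c where "b + ?m \<le> c" "c < length w" "factor_occ q w b"
      "letter_compat x q (w ! c) w b" by blast
    then have "is_occurrence [q, [x]] w (\<lambda>s. if s < ?m then b + s else c)"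
      unfolding is_occurrence_def Let_def strict_mono_on_def
      by (auto simp: factor_occ_def letter_compat_def All_less_Suc nth_append dash_after_right)
    then show ?L by blast
  qed
  then show ?thesis by (simp add: avoids_def)
qed

text \<open>Separates the two outer letters of \<open>[[x], q, [x]]\<close> from the positions of
  \<open>q\<close>, which are shifted by one.\<close>

lemma All_less_ends:
  "(\<forall>s<Suc (Suc m). P s) \<longleftrightarrow> P 0 \<and> (\<forall>s<m. P (Suc s)) \<and> P (Suc m)"
  unfolding All_less_Suc2[of "Suc m"] All_less_Suc[of m] by blast

lemma avoids_both_iff:
  assumes "q \<noteq> []"
  shows "avoids w [[x], q, [x]] \<longleftrightarrow>
    \<not> (\<exists>a b c. a < b \<and> b + length q \<le> c \<and> c < length w \<and> factor_occ q w b \<and>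
         letter_compat x q (w ! a) w b \<and> letter_compat x q (w ! c) w b)"
proof -
  let ?m = "length q"
  have m: "0 < ?m" using assms by simp
  have "(\<exists>j. is_occurrence [[x], q, [x]] w j) \<longleftrightarrow>
    (\<exists>a b c. a < b \<and> b + ?m \<le> c \<and> c < length w \<and> factor_occ q w b \<and>
         letter_compat x q (w ! a) w b \<and> letter_compat x q (w ! c) w b)" (is "?L \<longleftrightarrow> ?R")
  proof
    assume ?L
    then obtain j where j: "is_occurrence [[x], q, [x]] w j" by blast
    define b where "b = j (Suc 0)"
    have shift: "j (Suc s) = b + s" if "s < ?m" for s
      using consecutive_nat_fun[of ?m "\<lambda>s. j (Suc s)" s] j that
      by (auto simp: b_def is_occurrence_def Let_def dash_after_both)
    have "j 0 < b" "j ?m < j (Suc ?m)"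
      using j m unfolding b_def by (auto simp: is_occurrence_def Let_def strict_mono_on_def)
    then have "j 0 < b" "b + ?m \<le> j (Suc ?m)"
      using m shift[of "?m - 1"] by auto
    moreover have "j (Suc ?m) < length w" using j by (auto simp: is_occurrence_def Let_def)
    ultimately show ?R using j
      by (intro exI[of _ "j 0"] exI[of _ b] exI[of _ "j (Suc ?m)"])
         (auto simp: is_occurrence_def Let_def factor_occ_def letter_compat_def All_less_ends
           nth_append shift)
  next
    assume ?R
    then obtain a b c where "a < b" "b + ?m \<le> c" "c < length w" "factor_occ q w b"
      "letter_compat x q (w ! a) w b" "letter_compat x q (w ! c) w b" by blast
    then have "is_occurrence [[x], q, [x]] w
        (case_nat a (\<lambda>s. if s < ?m then b + s else c))"
      unfolding is_occurrence_def Let_def strict_mono_on_def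
      by (auto simp: factor_occ_def letter_compat_def All_less_ends
               nth_append dash_after_both split: nat.split)
    then show ?L by blast
  qed
  then show ?thesis by (simp add: avoids_def)
qed

text \<open>Strictness in the pattern and weak extremality in the word suffice: each factor letter
  lies strictly beyond some letter of \<open>w\<close>, on the side away from \<open>z\<close>.
  Hence it differs from \<open>z\<close>, and \<open>z\<close> is compatible with the
  factor.\<close>

lemma avoids_split_at_extremum:
  fixes w :: "'a::linorder list"
  assumes q: "q \<noteq> []" and w: "w = l @ [z] @ r"
    and ext: "(\<forall>y\<in>set q. y < x) \<and> (\<forall>v\<in>set w. v \<le> z) \<or> (\<forall>y\<in>set q. x < y) \<and> (\<forall>v\<in>set w. z \<le> v)"
  shows "avoids w [[x], q, [x]] \<longleftrightarrow> avoids l [[x], q] \<and> avoids r [q, [x]]"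
proof -
  let ?m = "length q" and ?p = "length l"
  have nz: "w ! ?p = z" and nl: "\<And>i. i < ?p \<Longrightarrow> w ! i = l ! i"
    and nr: "\<And>i. w ! (Suc ?p + i) = r ! i" and len: "length w = Suc (?p + length r)"
    using w by (auto simp: nth_append)
  \<comment> \<open>For a maximum, factor letters are below \<open>v\<close> \<le> \<open>z\<close>,
    and the opposite condition is vacuous because no letter of \<open>q\<close> exceeds
    \<open>x\<close>. A minimum is dual.\<close>
  have ext_compat: "letter_compat x q z w b" if "letter_compat x q v w b" "v \<in> set w" for v b
    using ext that unfolding letter_compat_def
    by (meson nth_mem order.strict_trans1 order.strict_trans2 order.asym)
  have z_outside: "b + ?m \<le> ?p \<or> ?p < b" if "letter_compat x q v w b" "v \<in> set w" for v b
  proof (rule ccontr)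
    assume "\<not> ?thesis"
    then obtain s where s: "s < ?m" "?p = b + s"
      by (metis le_add_diff_inverse nat_add_left_cancel_less not_le)
    then show False using ext that nz nth_mem[of s q] unfolding letter_compat_def
      by (metis leD)
  qed
  have factor_l: "factor_occ q w b \<longleftrightarrow> factor_occ q l b" if "b + ?m \<le> ?p" for b
    using that by (auto simp: factor_occ_def nl len)
  have compat_l: "letter_compat x q v w b \<longleftrightarrow> letter_compat x q v l b" if "b + ?m \<le> ?p" for v b
    using that by (auto simp: letter_compat_def nl)
  \<comment> \<open>The same shift as \<open>nr\<close>, with the index in the form the simplifier
    produces.\<close>
  have nr': "w ! (Suc (?p + b + s)) = r ! (b + s)" for b s
    using nr[of "b + s"] by (simp add: add.assoc)
  have factor_r: "factor_occ q w (Suc ?p + b) \<longleftrightarrow> factor_occ q r b" for b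
    by (auto simp: factor_occ_def nr' len)
  have compat_r: "letter_compat x q v w (Suc ?p + b) \<longleftrightarrow> letter_compat x q v r b" for v b
    by (auto simp: letter_compat_def nr')
  have "(\<exists>a b c. a < b \<and> b + ?m \<le> c \<and> c < length w \<and> factor_occ q w b \<and>
         letter_compat x q (w ! a) w b \<and> letter_compat x q (w ! c) w b) \<longleftrightarrow>
    (\<exists>a b. a < b \<and> factor_occ q l b \<and> letter_compat x q (l ! a) l b) \<or>
    (\<exists>b c. b + ?m \<le> c \<and> c < length r \<and> factor_occ q r b \<and> letter_compat x q (r ! c) r b)"
    (is "?W \<longleftrightarrow> ?A \<or> ?B")
  proof
    assume ?W
    then obtain a b c where h: "a < b" "b + ?m \<le> c" "c < length w" "factor_occ q w b"
      "letter_compat x q (w ! a) w b" "letter_compat x q (w ! c) w b" by blast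
    from z_outside[OF h(6) nth_mem[OF h(3)]] show "?A \<or> ?B"
    proof
      \<comment> \<open>The letter at \<open>c\<close> is dropped; \<open>a < b\<close> keeps the
        remaining outer letter in \<open>l\<close>.\<close>
      assume b: "b + ?m \<le> ?p"
      then have "factor_occ q l b" "letter_compat x q (l ! a) l b"
        using h factor_l compat_l nl[of a] by auto
      then show ?thesis using h(1) by blast
    next
      \<comment> \<open>Here the letter at \<open>a\<close> is dropped. Both \<open>b\<close> and
        \<open>c\<close> lie beyond \<open>z\<close>, so subtracting \<open>Suc ?p\<close> gives
        positions in \<open>r\<close>.\<close>
      assume "?p < b"
      then obtain b' c' where bc: "b = Suc ?p + b'" "c = Suc ?p + c'"
        using h(2) by (metis Suc_leI le_add1 le_Suc_ex order.trans)
      then have "b' + ?m \<le> c'" "c' < length r" "factor_occ q r b'" "letter_compat x q (r ! c') r b'"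
        using h len factor_r compat_r nr[of c'] by auto
      then show ?thesis by blast
    qed
  next
    assume "?A \<or> ?B"
    then show ?W
    proof
      assume ?A
      then obtain a b where h: "a < b" "factor_occ q l b" "letter_compat x q (l ! a) l b" by blast
      have b: "b + ?m \<le> ?p" using h(2) by (simp add: factor_occ_def)
      then have h': "factor_occ q w b" "letter_compat x q (w ! a) w b"
        using h factor_l compat_l nl[of a] by auto
      \<comment> \<open>The missing last letter is \<open>z\<close> itself: \<open>c\<close> is
        taken to be \<open>?p\<close>.\<close>
      moreover have "letter_compat x q (w ! ?p) w b"
        using ext_compat[OF h'(2)] b h(1) len nz by simp
      ultimately show ?W using h(1) b len by (metis less_add_Suc1)
    next
      assume ?B
      then obtain b c where h: "b + ?m \<le> c" "c < length r" "factor_occ q r b"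
        "letter_compat x q (r ! c) r b" by blast
      have h': "factor_occ q w (Suc ?p + b)" "letter_compat x q (w ! (Suc ?p + c)) w (Suc ?p + b)"
        using h factor_r compat_r nr[of c] by auto
      \<comment> \<open>Now \<open>z\<close> supplies the missing first letter, with
        \<open>a\<close> taken to be \<open>?p\<close>.\<close>
      moreover have "letter_compat x q (w ! ?p) w (Suc ?p + b)"
        using ext_compat[OF h'(2)] h(2) len nz by simp
      ultimately show ?W using h(1,2) len
        by (intro exI[of _ ?p] exI[of _ "Suc ?p + b"] exI[of _ "Suc ?p + c"]) auto
    qed
  qed
  then show ?thesis
    using q by (simp add: avoids_both_iff avoids_left_iff avoids_right_iff)
qed

theorem corollary10:
  fixes I :: "'i set" and \<sigma> :: "'i \<Rightarrow> pattern" and k :: "'i \<Rightarrow> nat"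
    and n :: nat and \<pi> \<pi>l \<pi>r \<pi>l' \<pi>r' :: "nat list"
  assumes "\<And>i. i \<in> I \<Longrightarrow> contiguous_pattern (\<sigma> i)"
    and "n \<ge> 1"
    and "\<pi> \<in> permutations_of_set {1..n}"
    and "\<pi> = \<pi>l @ [n] @ \<pi>r"
    and "\<pi> = \<pi>l' @ [1] @ \<pi>r'"
  shows "((\<forall>i\<in>I. \<forall>x\<in>set (concat (\<sigma> i)). x < k i) \<longrightarrow>
            ((\<forall>i\<in>I. avoids \<pi> ([[k i]] @ \<sigma> i @ [[k i]])) \<longleftrightarrow>
              (\<forall>i\<in>I. avoids \<pi>l ([[k i]] @ \<sigma> i)) \<and> (\<forall>i\<in>I. avoids \<pi>r (\<sigma> i @ [[k i]]))))
       \<and> ((\<forall>i\<in>I. \<forall>x\<in>set (concat (\<sigma> i)). 1 < x) \<longrightarrow>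
            ((\<forall>i\<in>I. avoids \<pi> ([[1]] @ \<sigma> i @ [[1]])) \<longleftrightarrow>
              (\<forall>i\<in>I. avoids \<pi>l' ([[1]] @ \<sigma> i)) \<and> (\<forall>i\<in>I. avoids \<pi>r' (\<sigma> i @ [[1]]))))"
proof -
  have set_pi: "set \<pi> = {1..n}"
    using assms(3) by (auto simp: permutations_of_set_def)
  have block: "\<exists>q. \<sigma> i = [q] \<and> q \<noteq> []" if "i \<in> I" for i
    using assms(1)[OF that]
    by (auto simp: contiguous_pattern_def is_pattern_def length_Suc_conv)
  \<comment> \<open>The equivalence holds for each index separately, with \<open>z = n\<close> and
    \<open>x = k i\<close>; the quantifier over \<open>I\<close> is distributed only at the
    end.\<close>
  have max: "avoids \<pi> ([[k i]] @ \<sigma> i @ [[k i]]) \<longleftrightarrow>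
      avoids \<pi>l ([[k i]] @ \<sigma> i) \<and> avoids \<pi>r (\<sigma> i @ [[k i]])"
    if i: "i \<in> I" and "\<forall>x\<in>set (concat (\<sigma> i)). x < k i" for i
  proof -
    obtain q where "\<sigma> i = [q]" "q \<noteq> []" using block[OF i] by blast
    then show ?thesis
      using avoids_split_at_extremum[OF _ assms(4), of q "k i"] that set_pi by simp
  qed
  \<comment> \<open>The dual case of the extremum, with both \<open>x\<close> and \<open>z\<close>
    equal to 1.\<close>
  have min: "avoids \<pi> ([[1]] @ \<sigma> i @ [[1]]) \<longleftrightarrow>
      avoids \<pi>l' ([[1]] @ \<sigma> i) \<and> avoids \<pi>r' (\<sigma> i @ [[1]])"
    if i: "i \<in> I" and "\<forall>x\<in>set (concat (\<sigma> i)). 1 < x" for i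
  proof -
    obtain q where "\<sigma> i = [q]" "q \<noteq> []" using block[OF i] by blast
    then show ?thesis
      using avoids_split_at_extremum[OF _ assms(5), of q 1] that set_pi by simp
  qed
  show ?thesis using max min by blast
qed

end
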